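(* Let $X$ be a Tychonoff space, let $E\subset C(X)$ be a sublattice with $\mathrm{supp}\,E=X$, and let $U,V\subset X$ be open. If $E=E(U)+E(V)$, then $U\cup V=X$. The converse (i.e. $U\cup V=X$ implies $E=E(U)+E(V)$) holds in each of the following cases: (i) $E$ is dense in $C(X)$ and $U,V$ are co-compact; (ii) $E$ is Urysohn and either $U$ or $V$ is co-compact; (iii) $X$ is normal and either $E=C(X)$ or $E$ is a dense sublattice of $C_b(X)$; (iv) $U\cap V=\varnothing$ (and so $U,V$ are clopen) and either $E=C(X)$ or $E$ is a dense sublattice of $C_b(X)$.
   Context: $C(X)$ is the vector lattice of all continuous real-valued functions on $X$ with the compact-open topology; $C_b(X)$ is the Banach lattice of bounded continuous functions with the supremum norm (density in each is with respect to the indicated topology). A sublattice is a linear subspace closed under the pointwise lattice operations. For a function $f$, $\mathrm{supp}\,f=\{x\in X:f(x)\ne0\}$ (no closure taken); for a set $G$ of functions, $\mathrm{supp}\,G=\bigcup_{g\in G}\mathrm{supp}\,g$. For $A\subset X$, $E(A)=\{f\in E:\mathrm{supp}\,f\subset A\}$. A set is co-compact if its complement in $X$ is compact. A sublattice $E\subset C(X)$ is Urysohn if for every $x\in X$ and every open neighborhood $U$ of $x$ there is $f\in E(U)$ with $f(x)=1$. *)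

theory Defs
  imports "HOL-Analysis.Analysis"
begin

text \<open>
  Spaces are abstract topologies, so a function on \<open>X\<close> is represented by its unique
  representative that is extensional on \<open>topspace X\<close>. This is the convention of
  \<^const>\<open>cfunspace\<close>, which serves as \<open>C\<^sub>b(X)\<close> with the supremum metric, and it is why the
  pointwise operations below are restricted to \<open>topspace X\<close>.
\<close>

definition cont_funs :: "'a topology \<Rightarrow> ('a \<Rightarrow> real) set" where
  "cont_funs X = {f. continuous_map X euclideanreal f \<and> f \<in> extensional (topspace X)}"

definition compact_open_topology :: "'a topology \<Rightarrow> ('a \<Rightarrow> real) topology" where
  "compact_open_topology X = topology_generated_by
     {{f \<in> cont_funs X. f ` K \<subseteq> W} | K W. compactin X K \<and> open W}"

lemma topspace_compact_open_topology [simp]: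
  "topspace (compact_open_topology X) = cont_funs X"
proof -
  have "{f \<in> cont_funs X. f ` {} \<subseteq> UNIV}
      \<in> {{f \<in> cont_funs X. f ` K \<subseteq> W} | K W. compactin X K \<and> open W}"
    by blast
  then show ?thesis
    unfolding compact_open_topology_def topology_generated_by_topspace by auto
qed

definition bounded_cont_funs_topology :: "'a topology \<Rightarrow> ('a \<Rightarrow> real) topology" where
  "bounded_cont_funs_topology X = mtopology_of (cfunspace X euclidean_metric)"

definition dense_in :: "'b topology \<Rightarrow> 'b set \<Rightarrow> bool" where
  "dense_in T S \<longleftrightarrow> S \<subseteq> topspace T \<and> T closure_of S = topspace T"

definition sublattice :: "'a topology \<Rightarrow> ('a \<Rightarrow> real) set \<Rightarrow> bool" where
  "sublattice X E \<longleftrightarrow>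
     E \<subseteq> cont_funs X \<and>
     (\<lambda>x\<in>topspace X. 0) \<in> E \<and>
     (\<forall>f\<in>E. \<forall>g\<in>E. (\<lambda>x\<in>topspace X. f x + g x) \<in> E) \<and>
     (\<forall>c. \<forall>f\<in>E. (\<lambda>x\<in>topspace X. c * f x) \<in> E) \<and>
     (\<forall>f\<in>E. \<forall>g\<in>E. (\<lambda>x\<in>topspace X. max (f x) (g x)) \<in> E) \<and>
     (\<forall>f\<in>E. \<forall>g\<in>E. (\<lambda>x\<in>topspace X. min (f x) (g x)) \<in> E)"

text \<open>No closure is taken in the support.\<close>

definition supp :: "'a topology \<Rightarrow> ('a \<Rightarrow> real) \<Rightarrow> 'a set" where
  "supp X f = {x \<in> topspace X. f x \<noteq> 0}"

definition supp_set :: "'a topology \<Rightarrow> ('a \<Rightarrow> real) set \<Rightarrow> 'a set" where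
  "supp_set X G = (\<Union>g\<in>G. supp X g)"

definition supported_in :: "'a topology \<Rightarrow> ('a \<Rightarrow> real) set \<Rightarrow> 'a set \<Rightarrow> ('a \<Rightarrow> real) set" where
  "supported_in X E A = {f \<in> E. supp X f \<subseteq> A}"

definition fun_set_sum ::
    "'a topology \<Rightarrow> ('a \<Rightarrow> real) set \<Rightarrow> ('a \<Rightarrow> real) set \<Rightarrow> ('a \<Rightarrow> real) set" where
  "fun_set_sum X F G = {\<lambda>x\<in>topspace X. f x + g x | f g. f \<in> F \<and> g \<in> G}"

definition co_compact :: "'a topology \<Rightarrow> 'a set \<Rightarrow> bool" where
  "co_compact X A \<longleftrightarrow> compactin X (topspace X - A)"

definition Urysohn_sublattice :: "'a topology \<Rightarrow> ('a \<Rightarrow> real) set \<Rightarrow> bool" where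
  "Urysohn_sublattice X E \<longleftrightarrow> sublattice X E \<and>
     (\<forall>x\<in>topspace X. \<forall>U. openin X U \<and> x \<in> U \<longrightarrow> (\<exists>f\<in>supported_in X E U. f x = 1))"

end

theory Submission
  imports Defs
begin

text \<open>
  A decomposition \<open>f = g + h\<close> with \<open>supp g \<subseteq> U\<close> and \<open>supp h \<subseteq> V\<close> is a function
  \<open>g\<close> that vanishes off \<open>U\<close> and equals \<open>f\<close> off \<open>V\<close>. Multiplying \<open>f\<close> by a cut-off function would
  give it, but a sublattice need not be closed under products. Truncation replaces the product: if
  some \<open>e \<in> E\<close> satisfies \<open>e \<le> 0\<close> off \<open>U\<close> and \<open>e \<ge> \<bar>f\<bar>\<close> off \<open>V\<close>, then clamping \<open>f\<close> between
  \<open>-e\<^sup>+\<close> and \<open>e\<^sup>+\<close> uses lattice operations only and produces \<open>g\<close>. This is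
  \<open>fun_set_sum_eq_if_dominators\<close>, and each of the four cases of the converse is a way of finding
  such a dominator \<open>e\<close>.

  If \<open>E\<close> is dense, it suffices to find a continuous function that is \<open>-1\<close> off \<open>U\<close> and exceeds
  \<open>\<bar>f\<bar>\<close> by at least \<open>1\<close> off \<open>V\<close>, because \<open>E\<close> contains a close approximation of it, and an approximation on
  the two complements is enough; if \<open>E\<close> is all of \<open>C(X)\<close>, a cut-off times \<open>\<bar>f\<bar>\<close> serves directly.
  The cut-off exists because the complements of \<open>U\<close> and \<open>V\<close> are disjoint closed
  sets that are compact, or lie in a normal space, or are clopen. If \<open>E\<close> is Urysohn and \<open>V\<close> is
  co-compact, finitely many multiples of bump functions in \<open>E(U)\<close> cover the complement of \<open>V\<close>,
  and their maximum dominates \<open>\<bar>f\<bar>\<close> there. The roles of \<open>U\<close> and \<open>V\<close> can be exchanged since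
  addition commutes.

  In the forward direction, a point missed by both \<open>U\<close> and \<open>V\<close> would be a common zero of \<open>E\<close>,
  and \<open>supp E = X\<close> excludes those.
\<close>

section \<open>Decomposition by truncation\<close>

lemma sublattice_add:
  "sublattice X E \<Longrightarrow> f \<in> E \<Longrightarrow> g \<in> E \<Longrightarrow> (\<lambda>x\<in>topspace X. f x + g x) \<in> E"
  unfolding sublattice_def by blast

lemma sublattice_scale:
  "sublattice X E \<Longrightarrow> f \<in> E \<Longrightarrow> (\<lambda>x\<in>topspace X. c * f x) \<in> E"
  unfolding sublattice_def by blast

lemma sublattice_max:
  "sublattice X E \<Longrightarrow> f \<in> E \<Longrightarrow> g \<in> E \<Longrightarrow> (\<lambda>x\<in>topspace X. max (f x) (g x)) \<in> E"
  unfolding sublattice_def by blast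

lemma sublattice_min:
  "sublattice X E \<Longrightarrow> f \<in> E \<Longrightarrow> g \<in> E \<Longrightarrow> (\<lambda>x\<in>topspace X. min (f x) (g x)) \<in> E"
  unfolding sublattice_def by blast

lemma sublattice_zero: "sublattice X E \<Longrightarrow> (\<lambda>x\<in>topspace X. 0) \<in> E"
  unfolding sublattice_def by blast

lemma sublattice_continuous:
  "sublattice X E \<Longrightarrow> f \<in> E \<Longrightarrow> continuous_map X euclideanreal f"
  unfolding sublattice_def cont_funs_def by blast

lemma sublattice_extensional: "sublattice X E \<Longrightarrow> f \<in> E \<Longrightarrow> f \<in> extensional (topspace X)"
  unfolding sublattice_def cont_funs_def by blast

lemma fun_set_sum_commute: "fun_set_sum X F G = fun_set_sum X G F"
proof -
  have "fun_set_sum X F G \<subseteq> fun_set_sum X G F" for F G :: "('a \<Rightarrow> real) set"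
    unfolding fun_set_sum_def by (force simp: add.commute)
  then show ?thesis
    by blast
qed

lemma fun_set_sum_supported_subset:
  assumes "sublattice X E"
  shows "fun_set_sum X (supported_in X E U) (supported_in X E V) \<subseteq> E"
  using sublattice_add[OF assms] unfolding fun_set_sum_def supported_in_def by blast

text \<open>
  Off \<open>U\<close> the interval \<open>[-e\<^sup>+, e\<^sup>+]\<close> is \<open>{0}\<close>, so the clamped function \<open>g\<close> vanishes there; off
  \<open>V\<close> the interval contains the value of \<open>f\<close>, so \<open>f - g\<close> vanishes there.
\<close>

lemma clamp_decomposition:
  assumes E: "sublattice X E" and f: "f \<in> E" and e: "e \<in> E"
    and offU: "\<And>x. x \<in> topspace X - U \<Longrightarrow> e x \<le> 0"
    and offV: "\<And>x. x \<in> topspace X - V \<Longrightarrow> \<bar>f x\<bar> \<le> e x"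
  shows "f \<in> fun_set_sum X (supported_in X E U) (supported_in X E V)"
proof -
  (* Each lattice or linear operation gets its own restricted function, so that the closure
     properties of E apply one at a time; p, m, n are e^+, -e^+, -g. *)
  define p where "p = (\<lambda>x\<in>topspace X. max (e x) ((\<lambda>x\<in>topspace X. 0) x))"
  define m where "m = (\<lambda>x\<in>topspace X. -1 * p x)"
  define q where "q = (\<lambda>x\<in>topspace X. min (f x) (p x))"
  define g where "g = (\<lambda>x\<in>topspace X. max (q x) (m x))"
  define n where "n = (\<lambda>x\<in>topspace X. -1 * g x)"
  define h where "h = (\<lambda>x\<in>topspace X. f x + n x)"
  have p: "p \<in> E"
    unfolding p_def by (intro sublattice_max[OF E] sublattice_zero[OF E] e)
  have m: "m \<in> E"
    unfolding m_def by (rule sublattice_scale[OF E p])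
  have q: "q \<in> E"
    unfolding q_def by (rule sublattice_min[OF E f p])
  have g: "g \<in> E"
    unfolding g_def by (rule sublattice_max[OF E q m])
  have n: "n \<in> E"
    unfolding n_def by (rule sublattice_scale[OF E g])
  have h: "h \<in> E"
    unfolding h_def by (rule sublattice_add[OF E f n])
  have g_eq: "g x = max (min (f x) (max (e x) 0)) (- max (e x) 0)" if "x \<in> topspace X" for x
    using that by (simp add: g_def q_def m_def p_def)
  have "supp X g \<subseteq> U"
    using offU by (force simp: supp_def g_eq)
  moreover have "h x = 0" if "x \<in> topspace X - V" for x
    using that offV[OF that] by (auto simp: h_def n_def g_eq)
  then have "supp X h \<subseteq> V"
    by (auto simp: supp_def)
  moreover have "f = (\<lambda>x\<in>topspace X. g x + h x)"
    using sublattice_extensional[OF E f]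
    by (auto simp: h_def n_def fun_eq_iff extensional_def)
  ultimately show ?thesis
    using g h unfolding fun_set_sum_def supported_in_def by blast
qed

lemma fun_set_sum_eq_if_dominators:
  assumes "sublattice X E"
    and "\<And>f. f \<in> E \<Longrightarrow> \<exists>e\<in>E. (\<forall>x\<in>topspace X - U. e x \<le> 0) \<and> (\<forall>x\<in>topspace X - V. \<bar>f x\<bar> \<le> e x)"
  shows "E = fun_set_sum X (supported_in X E U) (supported_in X E V)"
proof
  show "E \<subseteq> fun_set_sum X (supported_in X E U) (supported_in X E V)"
  proof
    fix f assume f: "f \<in> E"
    then obtain e where "e \<in> E" "\<forall>x\<in>topspace X - U. e x \<le> 0" "\<forall>x\<in>topspace X - V. \<bar>f x\<bar> \<le> e x"
      using assms(2) by blast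
    then show "f \<in> fun_set_sum X (supported_in X E U) (supported_in X E V)"
      by (intro clamp_decomposition[OF assms(1) f, of e]) auto
  qed
qed (rule fun_set_sum_supported_subset[OF assms(1)])

text \<open>All members of \<open>E(U) + E(V)\<close> vanish off \<open>U \<union> V\<close>, whereas \<open>E\<close> has no common zero.\<close>

lemma cover_if_fun_set_sum_eq:
  assumes "supp_set X E = topspace X" and "U \<subseteq> topspace X" and "V \<subseteq> topspace X"
    and eq: "E = fun_set_sum X (supported_in X E U) (supported_in X E V)"
  shows "U \<union> V = topspace X"
proof
  show "topspace X \<subseteq> U \<union> V"
  proof
    fix x assume x: "x \<in> topspace X"
    then obtain f where f: "f \<in> E" "f x \<noteq> 0"
      using assms(1) unfolding supp_set_def supp_def by blast
    then obtain g h where "g \<in> supported_in X E U" "h \<in> supported_in X E V"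
      and "f = (\<lambda>x\<in>topspace X. g x + h x)"
      using eq unfolding fun_set_sum_def by blast
    moreover from this have "g x \<noteq> 0 \<or> h x \<noteq> 0"
      using f x by auto
    ultimately show "x \<in> U \<union> V"
      using x unfolding supported_in_def supp_def by blast
  qed
qed (use assms in blast)

section \<open>Dominators from density\<close>

lemma bounded_on_compactin:
  assumes "continuous_map X euclideanreal f" and "compactin X K"
  obtains M where "M \<ge> 0" and "\<And>x. x \<in> K \<Longrightarrow> \<bar>f x\<bar> \<le> M"
proof -
  have "bounded (f ` K)"
    using image_compactin[OF assms(2,1)] by (simp add: compact_imp_bounded)
  then obtain M where "\<forall>x\<in>K. \<bar>f x\<bar> \<le> M"
    by (auto simp: bounded_iff)
  then show ?thesis
    using that[of "max M 0"] by force
qed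

lemma openin_compact_open:
  assumes "compactin X K" and "open W"
  shows "openin (compact_open_topology X) {f \<in> cont_funs X. f ` K \<subseteq> W}"
  unfolding compact_open_topology_def
  by (rule topology_generated_by_Basis) (use assms in blast)

text \<open>
  The sign condition on \<open>X - U\<close> and the lower bound on \<open>X - V\<close> each define a subbasic
  open set of the compact-open topology when the complements are compact; a Urysohn function
  shows that the two sets meet.
\<close>

lemma dominator_if_dense_compact_open:
  assumes X: "completely_regular_space X" and U: "openin X U"
    and dense: "dense_in (compact_open_topology X) E"
    and KU: "compactin X (topspace X - U)" and KV: "compactin X (topspace X - V)"
    and cover: "U \<union> V = topspace X" and f: "continuous_map X euclideanreal f"
  shows "\<exists>e\<in>E. (\<forall>x\<in>topspace X - U. e x \<le> 0) \<and> (\<forall>x\<in>topspace X - V. \<bar>f x\<bar> \<le> e x)"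
proof -
  obtain M where "M \<ge> 0" and M: "\<And>x. x \<in> topspace X - V \<Longrightarrow> \<bar>f x\<bar> \<le> M"
    using bounded_on_compactin[OF f KV] by blast
  define A where "A = {f \<in> cont_funs X. f ` (topspace X - U) \<subseteq> {..<0}}
      \<inter> {f \<in> cont_funs X. f ` (topspace X - V) \<subseteq> {M<..}}"
  have "openin (compact_open_topology X) A"
    unfolding A_def by (intro openin_Int openin_compact_open KU KV) auto
  moreover obtain k where "continuous_map X (top_of_set {-1..M + 1}) k"
    and k: "k ` (topspace X - U) \<subseteq> {-1}" "k ` (topspace X - V) \<subseteq> {M + 1}"
    using Urysohn_completely_regular_compact_closed[of "-1" "M + 1" X "topspace X - V" "topspace X - U"]
      X KV U cover \<open>M \<ge> 0\<close> by (auto simp: disjnt_def)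
  then have "continuous_map X euclideanreal (restrict k (topspace X))"
    by (simp add: continuous_map_in_subtopology)
  then have "restrict k (topspace X) \<in> A"
    using k by (fastforce simp: A_def cont_funs_def)
  ultimately obtain e where "e \<in> E" "e \<in> A"
    using dense unfolding dense_in_def dense_intersects_open by blast
  then show ?thesis
    using M unfolding A_def by (intro bexI[of _ e]) fastforce+
qed

lemma mspace_cfunspace_euclidean:
  "mspace (cfunspace X euclidean_metric) = {f \<in> cont_funs X. bounded (f ` topspace X)}"
  by (auto simp: cont_funs_def)

lemma uniformly_dense_approximation:
  assumes "dense_in (bounded_cont_funs_topology X) E"
    and "k \<in> cont_funs X" and "bounded (k ` topspace X)" and "\<epsilon> > 0"
  shows "\<exists>e\<in>E. \<forall>x\<in>topspace X. \<bar>k x - e x\<bar> \<le> \<epsilon>"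
proof -
  interpret C: Metric_space "mspace (cfunspace X euclidean_metric)" "mdist (cfunspace X euclidean_metric)"
    by (rule Metric_space_mspace_mdist)
  have k: "k \<in> mspace (cfunspace X euclidean_metric)"
    unfolding mspace_cfunspace_euclidean using assms by blast
  then have "k \<in> C.mtopology closure_of E"
    using assms(1) unfolding dense_in_def bounded_cont_funs_topology_def mtopology_of_def
    by (metis C.topspace_mtopology)
  then obtain e where e: "e \<in> E" "e \<in> C.mball k \<epsilon>"
    using \<open>\<epsilon> > 0\<close> unfolding C.metric_closure_of by blast
  then have "e \<in> mspace (cfunspace X euclidean_metric)" "mdist (cfunspace X euclidean_metric) k e \<le> \<epsilon>"
    unfolding C.in_mball by auto
  then have "\<bar>k x - e x\<bar> \<le> \<epsilon>" if "x \<in> topspace X" for x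
    using mdist_cfunspace_imp_mdist_le[OF k _ _ that] by (fastforce simp: dist_real_def)
  then show ?thesis
    using e by blast
qed

text \<open>
  Normality and disjointness of \<open>U\<close> and \<open>V\<close> both yield a cut-off \<open>k\<close>. In the dense case
  \<open>k\<close> is rescaled to take the values \<open>-1\<close> and \<open>M + 1\<close>, where \<open>M\<close> bounds \<open>\<bar>f\<bar>\<close>: a uniform
  error of \<open>1\<close> is then harmless on both complements.
\<close>

lemma dominator_if_separated:
  assumes E: "E = cont_funs X \<or> dense_in (bounded_cont_funs_topology X) E"
    and f: "f \<in> E" and k: "continuous_map X euclideanreal k" "k ` topspace X \<subseteq> {0..1}"
    and kU: "\<And>x. x \<in> topspace X - U \<Longrightarrow> k x = 0"
    and kV: "\<And>x. x \<in> topspace X - V \<Longrightarrow> k x = 1"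
  shows "\<exists>e\<in>E. (\<forall>x\<in>topspace X - U. e x \<le> 0) \<and> (\<forall>x\<in>topspace X - V. \<bar>f x\<bar> \<le> e x)"
  using E
proof
  assume E: "E = cont_funs X"
  then have "continuous_map X euclideanreal f"
    using f by (simp add: cont_funs_def)
  then have "(\<lambda>x\<in>topspace X. k x * \<bar>f x\<bar>) \<in> E"
    unfolding E using k(1)
    by (simp add: cont_funs_def continuous_map_real_mult continuous_map_real_abs)
  then show ?thesis
    by (rule bexI[rotated]) (simp add: kU kV)
next
  assume dense: "dense_in (bounded_cont_funs_topology X) E"
  then have "f \<in> mspace (cfunspace X euclidean_metric)"
    using f unfolding dense_in_def bounded_cont_funs_topology_def by auto
  then have "bounded (f ` topspace X)"
    unfolding mspace_cfunspace_euclidean by blast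
  then obtain M where M: "\<And>x. x \<in> topspace X \<Longrightarrow> \<bar>f x\<bar> \<le> M"
    by (auto simp: bounded_iff)
  define k' where "k' = (\<lambda>x\<in>topspace X. (M + 2) * k x - 1)"
  have "k' \<in> cont_funs X"
    using k(1) by (simp add: k'_def cont_funs_def continuous_map_diff continuous_map_real_mult_left)
  moreover have "bounded (k' ` topspace X)"
  proof -
    have "bounded ((\<lambda>y. (M + 2) * y - 1) ` {0..1})"
      by (intro compact_imp_bounded compact_continuous_image continuous_intros) auto
    then show ?thesis
      by (rule bounded_subset) (use k(2) in \<open>auto simp: k'_def\<close>)
  qed
  ultimately obtain e where "e \<in> E" and e: "\<And>x. x \<in> topspace X \<Longrightarrow> \<bar>k' x - e x\<bar> \<le> 1"
    using uniformly_dense_approximation[OF dense, of k' 1] by auto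
  have "e x \<le> 0" if "x \<in> topspace X - U" for x
    using that e[of x] kU[of x] by (simp add: k'_def)
  moreover have "\<bar>f x\<bar> \<le> e x" if "x \<in> topspace X - V" for x
    using that e[of x] kV[of x] M[of x] by (simp add: k'_def)
  ultimately show ?thesis
    using \<open>e \<in> E\<close> by blast
qed

section \<open>Dominators in Urysohn sublattices\<close>

lemma sublattice_finite_max:
  assumes E: "sublattice X E" and "finite F" and "\<And>i. i \<in> F \<Longrightarrow> b i \<in> E"
    and "\<And>i x. i \<in> F \<Longrightarrow> x \<in> topspace X - U \<Longrightarrow> b i x = 0"
  shows "\<exists>e\<in>E. (\<forall>x\<in>topspace X - U. e x = 0) \<and> (\<forall>i\<in>F. \<forall>x\<in>topspace X. b i x \<le> e x)"
  using assms(2-)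
proof (induction F rule: finite_induct)
  case empty
  then show ?case
    by (intro bexI[where x = "\<lambda>x\<in>topspace X. 0"] sublattice_zero[OF E]) simp
next
  case (insert j F)
  have "\<exists>e\<in>E. (\<forall>x\<in>topspace X - U. e x = 0) \<and> (\<forall>i\<in>F. \<forall>x\<in>topspace X. b i x \<le> e x)"
    by (rule insert.IH) (use insert.prems in blast)+
  then obtain e where e: "e \<in> E" "\<forall>x\<in>topspace X - U. e x = 0"
      "\<forall>i\<in>F. \<forall>x\<in>topspace X. b i x \<le> e x"
    by blast
  define d where "d = (\<lambda>x\<in>topspace X. max (b j x) (e x))"
  have "d \<in> E"
    unfolding d_def by (rule sublattice_max[OF E insert.prems(1)[OF insertI1] e(1)])
  moreover have "\<forall>x\<in>topspace X - U. d x = 0"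
    using insert.prems(2)[OF insertI1] e(2) by (simp add: d_def)
  moreover have "\<forall>i\<in>insert j F. \<forall>x\<in>topspace X. b i x \<le> d x"
    using e(3) by (auto simp: d_def max.coboundedI2)
  ultimately show ?case
    by blast
qed

text \<open>
  A bump at \<open>y\<close> multiplied by \<open>\<bar>f y\<bar> + 1\<close> exceeds \<open>\<bar>f\<bar>\<close> at \<open>y\<close>, hence on a neighbourhood of
  \<open>y\<close>; compactness leaves finitely many such bumps to combine.
\<close>

lemma Urysohn_dominator:
  assumes E: "Urysohn_sublattice X E" and U: "openin X U"
    and K: "compactin X K" "K \<subseteq> U" and f: "continuous_map X euclideanreal f"
  shows "\<exists>e\<in>E. (\<forall>x\<in>topspace X - U. e x = 0) \<and> (\<forall>x\<in>K. \<bar>f x\<bar> \<le> e x)"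
proof -
  have lat: "sublattice X E"
    using E by (simp add: Urysohn_sublattice_def)
  have KX: "K \<subseteq> topspace X"
    using K(1) by (rule compactin_subset_topspace)
  have "\<forall>y\<in>K. \<exists>u\<in>supported_in X E U. u y = 1"
    using E U K(2) KX unfolding Urysohn_sublattice_def by blast
  then obtain u where u: "\<And>y. y \<in> K \<Longrightarrow> u y \<in> supported_in X E U \<and> u y y = 1"
    by metis
  define b where "b y = (\<lambda>x\<in>topspace X. (\<bar>f y\<bar> + 1) * u y x)" for y
  define N where "N y = {x \<in> topspace X. b y x - \<bar>f x\<bar> \<in> {0<..}}" for y
  have bE: "b y \<in> E" if "y \<in> K" for y
    using sublattice_scale[OF lat] u[OF that] unfolding b_def supported_in_def by blast
  have b0: "b y x = 0" if "y \<in> K" "x \<in> topspace X - U" for x y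
    using u[OF that(1)] that(2) by (auto simp: b_def supported_in_def supp_def)
  have N: "openin X (N y)" if "y \<in> K" for y
    unfolding N_def
    by (intro openin_continuous_map_preimage[where Y = euclideanreal] continuous_map_diff
        continuous_map_real_abs f sublattice_continuous[OF lat bE[OF that]]) simp
  have "K \<subseteq> \<Union> (N ` K)"
    using KX u by (force simp: N_def b_def)
  then obtain \<F> where "finite \<F>" "\<F> \<subseteq> N ` K" "K \<subseteq> \<Union> \<F>"
    using K(1) N unfolding compactin_def by (metis (no_types, lifting) imageE)
  then obtain F where F: "finite F" "F \<subseteq> K" "K \<subseteq> \<Union> (N ` F)"
    by (metis finite_subset_image)
  obtain e where e: "e \<in> E" "\<forall>x\<in>topspace X - U. e x = 0" "\<forall>y\<in>F. \<forall>x\<in>topspace X. b y x \<le> e x"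
    using sublattice_finite_max[OF lat F(1), of b U] bE b0 F(2) by blast
  have "\<bar>f x\<bar> \<le> e x" if x: "x \<in> K" for x
  proof -
    obtain y where "y \<in> F" "x \<in> N y"
      using F(3) x by blast
    then have "\<bar>f x\<bar> < b y x" "b y x \<le> e x"
      using e(3) by (auto simp: N_def)
    then show ?thesis
      by simp
  qed
  then show ?thesis
    using e by blast
qed

lemma Urysohn_fun_set_sum_eq:
  assumes E: "Urysohn_sublattice X E" and "openin X U"
    and "co_compact X V" and "U \<union> V = topspace X"
  shows "E = fun_set_sum X (supported_in X E U) (supported_in X E V)"
proof (rule fun_set_sum_eq_if_dominators)
  show lat: "sublattice X E"
    using E by (simp add: Urysohn_sublattice_def)
  fix f assume "f \<in> E"
  then have "continuous_map X euclideanreal f"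
    by (rule sublattice_continuous[OF lat])
  moreover have "compactin X (topspace X - V)" "topspace X - V \<subseteq> U"
    using assms(3,4) by (auto simp: co_compact_def)
  ultimately obtain e where "e \<in> E" "\<forall>x\<in>topspace X - U. e x = 0" "\<forall>x\<in>topspace X - V. \<bar>f x\<bar> \<le> e x"
    using Urysohn_dominator[OF E assms(2)] by blast
  then show "\<exists>e\<in>E. (\<forall>x\<in>topspace X - U. e x \<le> 0) \<and> (\<forall>x\<in>topspace X - V. \<bar>f x\<bar> \<le> e x)"
    by (intro bexI[of _ e]) auto
qed

section \<open>The characterization of covers\<close>

lemma disjoint_open_cover_clopen:
  assumes "openin X U" and "openin X V" and "U \<union> V = topspace X" and "U \<inter> V = {}"
  shows "closedin X U" and "closedin X V"
proof -
  have "topspace X - U = V" "topspace X - V = U"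
    using assms(3,4) by auto
  then show "closedin X U" "closedin X V"
    using assms by (auto simp: closedin_def)
qed

lemma continuous_map_indicator_clopen:
  assumes "openin X U" and "closedin X U"
  shows "continuous_map X euclideanreal (indicator U)"
proof -
  have "openin X {x \<in> topspace X. indicator U x \<in> W}" for W :: "real set"
  proof -
    have "{x \<in> topspace X. indicator U x \<in> W} =
        (if 1 \<in> W then U else {}) \<union> (if 0 \<in> W then topspace X - U else {})"
      using openin_subset[OF assms(1)] by (auto simp: indicator_def)
    then show ?thesis
      using assms by auto
  qed
  then show ?thesis
    by (simp add: continuous_map)
qed

theorem proposition2p12:
  fixes X :: "'a topology" and E :: "('a \<Rightarrow> real) set" and U V :: "'a set"
  assumes "completely_regular_space X" and "Hausdorff_space X"
    and "sublattice X E" and "supp_set X E = topspace X"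
    and "openin X U" and "openin X V"
  shows
    "(E = fun_set_sum X (supported_in X E U) (supported_in X E V) \<longrightarrow> U \<union> V = topspace X) \<and>
     (U \<union> V = topspace X \<longrightarrow>
       (dense_in (compact_open_topology X) E \<and> co_compact X U \<and> co_compact X V \<longrightarrow>
         E = fun_set_sum X (supported_in X E U) (supported_in X E V)) \<and>
       (Urysohn_sublattice X E \<and> (co_compact X U \<or> co_compact X V) \<longrightarrow>
         E = fun_set_sum X (supported_in X E U) (supported_in X E V)) \<and>
       (normal_space X \<and> (E = cont_funs X \<or> dense_in (bounded_cont_funs_topology X) E) \<longrightarrow>
         E = fun_set_sum X (supported_in X E U) (supported_in X E V)) \<and>
       (U \<inter> V = {} \<longrightarrow>
         closedin X U \<and> closedin X V \<and>
         (E = cont_funs X \<or> dense_in (bounded_cont_funs_topology X) E \<longrightarrow>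
           E = fun_set_sum X (supported_in X E U) (supported_in X E V))))"
    (is "(?eq \<longrightarrow> _) \<and> _")
proof (intro conjI impI; (elim conjE)?)
  assume ?eq
  then show "U \<union> V = topspace X"
    using cover_if_fun_set_sum_eq[of X E U V] assms openin_subset by blast
next
  assume cover: "U \<union> V = topspace X" and dense: "dense_in (compact_open_topology X) E"
    and "co_compact X U" and "co_compact X V"
  then have "compactin X (topspace X - U)" "compactin X (topspace X - V)"
    by (simp_all add: co_compact_def)
  then show ?eq
    by (intro fun_set_sum_eq_if_dominators[OF assms(3)]
        dominator_if_dense_compact_open[OF assms(1,5) dense _ _ cover]
        sublattice_continuous[OF assms(3)])
next
  assume cover: "U \<union> V = topspace X" and E: "Urysohn_sublattice X E"
    and "co_compact X U \<or> co_compact X V"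
  then show ?eq
    using Urysohn_fun_set_sum_eq[OF E assms(5), of V] Urysohn_fun_set_sum_eq[OF E assms(6), of U]
    by (metis Un_commute fun_set_sum_commute)
next
  assume cover: "U \<union> V = topspace X" and "normal_space X"
    and E: "E = cont_funs X \<or> dense_in (bounded_cont_funs_topology X) E"
  moreover have "disjnt (topspace X - U) (topspace X - V)"
    using cover by (auto simp: disjnt_def)
  ultimately obtain k :: "'a \<Rightarrow> real" where "continuous_map X (top_of_set {0..1}) k"
    and k: "k ` (topspace X - U) \<subseteq> {0}" "k ` (topspace X - V) \<subseteq> {1}"
    using assms(5,6) unfolding normal_space_iff_Urysohn by (meson closedin_diff closedin_topspace)
  then have "continuous_map X euclideanreal k" "k ` topspace X \<subseteq> {0..1}"
    by (auto simp: continuous_map_in_subtopology)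
  then show ?eq
    using k
    by (intro fun_set_sum_eq_if_dominators[OF assms(3)] dominator_if_separated[OF E, where k = k])
      auto
next
  assume "U \<union> V = topspace X" and "U \<inter> V = {}"
  then show "closedin X U" and "closedin X V"
    using disjoint_open_cover_clopen[OF assms(5,6)] by blast+
next
  assume cover: "U \<union> V = topspace X" and disj: "U \<inter> V = {}"
    and E: "E = cont_funs X \<or> dense_in (bounded_cont_funs_topology X) E"
  have "continuous_map X euclideanreal (indicator U)"
    using assms(5) disjoint_open_cover_clopen(1)[OF assms(5,6) cover disj]
    by (rule continuous_map_indicator_clopen)
  moreover have "indicator U x = (1::real)" if "x \<in> topspace X - V" for x
    using that cover by (auto simp: indicator_def)
  moreover have "indicator U ` topspace X \<subseteq> {0..1::real}"
    by (auto simp: indicator_def)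
  ultimately show ?eq
    by (intro fun_set_sum_eq_if_dominators[OF assms(3)]
        dominator_if_separated[OF E, where k = "indicator U"]) auto
qed

end
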